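(* Marginals of $L_p$-nested symmetric distributions are not necessarily $L_p$-nested symmetric: there exist an $L_p$-nested function of the form $$f(\boldsymbol x)=\left(\left(|x_1|^{p_1}+|x_2|^{p_1}\right)^{\frac{p_\emptyset}{p_1}}+|x_3|^{p_\emptyset}\right)^{\frac1{p_\emptyset}},\qquad \boldsymbol x\in\mathbb R^3,\ p_\emptyset,p_1>0,$$ such that, if $\boldsymbol X$ is uniformly distributed inside the $L_p$-nested ball $\{\boldsymbol x\in\mathbb R^3:f(\boldsymbol x)\le1\}$, the marginal distribution of $(X_1,X_3)$ on $\mathbb R^2$ is not $L_p$-nested symmetric (with respect to any $L_p$-nested function on $\mathbb R^2$).
   Context: An $L_p$-nested function on $\mathbb R^n$ is a nested cascade of $L_p$-norms (with arbitrary exponents $p>0$) along a finite rooted tree whose leaves correspond to $|x_1|,\dots,|x_n|$: each inner node has at least two children and computes the $L_p$-norm, with its own exponent, of the values of its children, and the function value is the value at the root. In particular the $L_p$-nested functions on $\mathbb R^2$ are exactly $(|x_1|^p+|x_2|^p)^{1/p}$ with $p>0$. A distribution on $\mathbb R^n$ is $L_p$-nested symmetric with respect to an $L_p$-nested function $h$ if it has a Lebesgue density depending on $\boldsymbol x$ only through $h(\boldsymbol x)$. *)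

theory Defs
  imports "HOL-Probability.Probability"
begin

datatype 'n lp_tree = Leaf 'n | Node real "'n lp_tree list"

primrec leaves :: "'n lp_tree \<Rightarrow> 'n list" where
  "leaves (Leaf i) = [i]"
| "leaves (Node p ts) = concat (map leaves ts)"

primrec proper_nodes :: "'n lp_tree \<Rightarrow> bool" where
  "proper_nodes (Leaf i) \<longleftrightarrow> True"
| "proper_nodes (Node p ts) \<longleftrightarrow> p > 0 \<and> length ts \<ge> 2 \<and> list_all proper_nodes ts"

primrec lp_eval :: "'n::finite lp_tree \<Rightarrow> real ^ 'n \<Rightarrow> real" where
  "lp_eval (Leaf i) = (\<lambda>x. \<bar>x $ i\<bar>)"
| "lp_eval (Node p ts) =
     (\<lambda>x. (\<Sum>v\<leftarrow>map lp_eval ts. v x powr p) powr (1 / p))"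

definition Lp_nested :: "(real ^ 'n::finite \<Rightarrow> real) \<Rightarrow> bool" where
  "Lp_nested h \<longleftrightarrow>
     (\<exists>t. proper_nodes t \<and> distinct (leaves t) \<and> set (leaves t) = UNIV \<and> h = lp_eval t)"

(* The density is only determined almost everywhere: some version of it must be of the form
   g o h.  Only the density itself, not g, is required to be Borel measurable. *)
definition Lp_nested_symmetric_wrt ::
    "(real ^ 'n::finite \<Rightarrow> real) \<Rightarrow> (real ^ 'n) measure \<Rightarrow> bool" where
  "Lp_nested_symmetric_wrt h M \<longleftrightarrow> Lp_nested h \<and>
     (\<exists>\<rho> \<in> borel_measurable lborel. M = density lborel \<rho> \<and>
        (\<exists>g :: real \<Rightarrow> ennreal. \<forall>x. \<rho> x = g (h x)))"

definition Lp_nested_symmetric :: "(real ^ 'n::finite) measure \<Rightarrow> bool" where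
  "Lp_nested_symmetric M \<longleftrightarrow> (\<exists>h. Lp_nested_symmetric_wrt h M)"

end

(* Every Lp-nested function on the plane is invariant under exchanging the two coordinates, so
   an Lp-nested symmetric distribution on the plane is exchangeable.  For p0 = 2 and p1 = 1 the
   ball is x1^2 + x2^2 + x3^2 + 2 |x1| |x2| \<le> 1; exchanging x1 and x3 turns the mixed term into
   2 |x2| |x3|.  Where |x3| < |x1| the exchanged ball is therefore larger, by a set with interior,
   and so (X1, X3) gives {|x3| < |x1|} less mass than {|x1| < |x3|}. *)

theory Submission
  imports Defs
begin

definition swap_coords :: "'n \<Rightarrow> 'n \<Rightarrow> 'a ^ 'n \<Rightarrow> 'a ^ 'n" where
  "swap_coords a b x = (\<chi> i. x $ Transposition.transpose a b i)"

lemma swap_coords_nth [simp]: "swap_coords a b x $ i = x $ Transposition.transpose a b i"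
  by (simp add: swap_coords_def)

lemma borel_measurable_swap_coords [measurable]:
  "(swap_coords a b :: real ^ 'n::finite \<Rightarrow> _) \<in> borel_measurable borel"
  unfolding swap_coords_def by (intro borel_measurable_continuous_onI continuous_intros)

text \<open>Exchanging coordinates carries boxes to boxes and only permutes the side lengths, and a
  Borel measure that gives each box its volume is \<open>lborel\<close>.\<close>

lemma distr_lborel_swap_coords:
  "distr lborel borel (swap_coords a b) = (lborel :: (real ^ 'n::finite) measure)"
proof (rule lborel_eqI [symmetric])
  fix l u :: "real ^ 'n"
  assume le: "\<And>k. k \<in> Basis \<Longrightarrow> l \<bullet> k \<le> u \<bullet> k"
  have le_nth: "l $ i \<le> u $ i" for i
    using le [of "axis i 1"] by (simp add: inner_axis)
  \<comment> \<open>Indexing the side lengths by coordinates turns the claim into a reindexing of a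
    finite product along a bijection.\<close>
  have prod_Basis: "(\<Prod>k\<in>Basis. v \<bullet> k) = (\<Prod>i\<in>UNIV. v $ i)" for v :: "real ^ 'n"
  proof -
    have *: "(Basis :: (real ^ 'n) set) = range (\<lambda>i. axis i 1)"
      by (auto simp: Basis_vec_def)
    have "inj (\<lambda>i. axis i 1 :: real ^ 'n)"
      by (auto simp: inj_on_def axis_eq_axis)
    then show ?thesis
      unfolding * by (subst prod.reindex) (auto simp: inner_axis)
  qed
  let ?s = "swap_coords a b :: real ^ 'n \<Rightarrow> real ^ 'n"
  \<comment> \<open>A transposition is its own inverse, so the preimage is again a box, with both
    corners exchanged.\<close>
  have "?s -` box l u = box (?s l) (?s u)"
    unfolding box_def vimage_def mem_box_cart
    by (auto simp: Basis_vec_def inner_axis) (metis transpose_involutory)+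
  then have "emeasure (distr lborel borel ?s) (box l u) = emeasure lborel (box (?s l) (?s u))"
    by (simp add: emeasure_distr)
  also have "\<dots> = (\<Prod>k\<in>Basis. (?s u - ?s l) \<bullet> k)"
    by (rule emeasure_lborel_box) (auto simp: Basis_vec_def inner_axis le_nth)
  also have "(\<Prod>k\<in>Basis. (?s u - ?s l) \<bullet> k) = (\<Prod>k\<in>Basis. (u - l) \<bullet> k)"
    unfolding prod_Basis
    using prod.reindex_bij_betw [OF bij_transpose, of "\<lambda>i. (u - l) $ i" a b] by simp
  finally show "emeasure (distr lborel borel ?s) (box l u) = (\<Prod>k\<in>Basis. (u - l) \<bullet> k)" .
qed simp

lemma emeasure_lborel_swap_coords:
  assumes [measurable]: "A \<in> sets borel"
  shows "emeasure lborel {x. swap_coords a b x \<in> A} = emeasure lborel (A :: (real ^ 'n::finite) set)"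
proof -
  have "emeasure lborel A = emeasure (distr lborel borel (swap_coords a b)) A"
    by (simp add: distr_lborel_swap_coords)
  also have "\<dots> = emeasure lborel {x. swap_coords a b x \<in> A}"
    by (simp add: emeasure_distr vimage_def)
  finally show ?thesis ..
qed

lemma emeasure_lborel_open_pos:
  assumes "open S" "x \<in> S"
  shows "emeasure lborel (S :: 'a::euclidean_space set) > 0"
proof -
  obtain a b where box: "x \<in> box a b" "box a b \<subseteq> S"
    using assms by (metis openE order_trans rational_boxes)
  then have "0 < emeasure lborel (box a b)"
    by (auto simp: emeasure_lborel_box_eq mem_box algebra_simps intro!: prod_pos)
  also have "\<dots> \<le> emeasure lborel S"
    using assms box by (intro emeasure_mono) auto
  finally show ?thesis .
qed

text \<open>Every child contributes at least one leaf. These bounds leave only one shape for a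
  proper tree with two leaves.\<close>

lemma length_leaves:
  assumes "proper_nodes t"
  shows "1 \<le> length (leaves t)"
    and "t = Node p ts \<Longrightarrow> length ts \<le> length (leaves t)"
proof -
  have *: "1 \<le> length (leaves t) \<and> (\<forall>p ts. t = Node p ts \<longrightarrow> length ts \<le> length (leaves t))"
    using assms
  proof (induction t)
    case (Node p ts)
    have "(\<Sum>t\<leftarrow>ts. 1) \<le> (\<Sum>t\<leftarrow>ts. length (leaves t))"
      using Node by (intro sum_list_mono) (auto simp: list_all_iff)
    then show ?case
      using Node.prems by (auto simp: length_concat sum_list_triv o_def)
  qed simp
  show "1 \<le> length (leaves t)" and "t = Node p ts \<Longrightarrow> length ts \<le> length (leaves t)"
    using * by blast+
qed

lemma proper_one_leaf:
  assumes "proper_nodes t" "length (leaves t) = 1"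
  obtains i where "t = Leaf i"
  using assms length_leaves(2) by (cases t) fastforce+

text \<open>Two leaves rule out a bare leaf and allow at most two children at the root, hence
  exactly two, with one leaf each. The leaves may come in either order, which commutativity of
  addition absorbs.\<close>

lemma Lp_nested_2E:
  fixes h :: "real ^ 2 \<Rightarrow> real"
  assumes "Lp_nested h"
  obtains p where "p > 0" "h = (\<lambda>x. (\<bar>x $ 1\<bar> powr p + \<bar>x $ 2\<bar> powr p) powr (1 / p))"
proof -
  from assms obtain t :: "2 lp_tree" where t: "proper_nodes t" "distinct (leaves t)"
    "set (leaves t) = UNIV" "h = lp_eval t"
    unfolding Lp_nested_def by blast
  have len: "length (leaves t) = 2"
    using distinct_card [OF t(2)] t(3) by simp
  then obtain p ts where tn: "t = Node p ts"
    by (cases t) auto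
  then have "length ts = 2"
    using t(1) length_leaves(2) [OF t(1) tn] len by simp
  then obtain a b where ts: "ts = [a, b]"
    by (auto simp: length_Suc_conv numeral_2_eq_2)
  have pr: "proper_nodes a" "proper_nodes b" "p > 0"
    using t(1) tn ts by auto
  have "length (leaves a) + length (leaves b) = 2"
    using len tn ts by simp
  then have "length (leaves a) = 1" "length (leaves b) = 1"
    using length_leaves(1) [OF pr(1)] length_leaves(1) [OF pr(2)] by simp_all
  then obtain i j where ij: "a = Leaf i" "b = Leaf j"
    using pr proper_one_leaf by metis
  have "i \<noteq> j"
    using t(2) tn ts ij by auto
  then have "i = 1 \<and> j = 2 \<or> i = 2 \<and> j = 1"
    using exhaust_2 by metis
  then show ?thesis
    using that [OF pr(3)] t(4) tn ts ij by (auto simp: add.commute)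
qed

text \<open>The density factors pointwise through a function symmetric in the two coordinates, and
  Lebesgue measure is itself invariant under the exchange.\<close>

lemma Lp_nested_symmetric_exchangeable:
  fixes M :: "(real ^ 2) measure"
  assumes "Lp_nested_symmetric M"
  shows "distr M borel (swap_coords 1 2) = M"
proof -
  from assms obtain h \<rho> g where h: "Lp_nested h" and [measurable]: "\<rho> \<in> borel_measurable lborel"
    and M: "M = density lborel \<rho>" and \<rho>: "\<And>x. \<rho> x = g (h x)"
    unfolding Lp_nested_symmetric_def Lp_nested_symmetric_wrt_def by blast
  let ?s = "swap_coords 1 2 :: real ^ 2 \<Rightarrow> real ^ 2"
  have [simp]: "\<rho> (?s x) = \<rho> x" for x
    using h by (elim Lp_nested_2E) (simp add: \<rho> add.commute)
  have "M = density (distr lborel borel ?s) \<rho>"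
    by (simp add: distr_lborel_swap_coords M)
  also have "\<dots> = distr (density lborel (\<lambda>x. \<rho> (?s x))) borel ?s"
    by (rule density_distr) measurable
  also have "\<dots> = distr M borel ?s"
    by (simp add: M)
  finally show ?thesis ..
qed

theorem mainTheorem10:
  "\<exists>(f :: real ^ 3 \<Rightarrow> real) (p0 :: real) (p1 :: real).
     p0 > 0 \<and> p1 > 0 \<and> Lp_nested f \<and>
     (\<forall>x. f x = ((\<bar>x $ 1\<bar> powr p1 + \<bar>x $ 2\<bar> powr p1) powr (p0 / p1)
                  + \<bar>x $ 3\<bar> powr p0) powr (1 / p0)) \<and>
     \<not> Lp_nested_symmetric
         (distr (uniform_measure lborel {x. f x \<le> 1}) borel
            (\<lambda>x. vector [x $ 1, x $ 3] :: real ^ 2))"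
proof -
  define t :: "3 lp_tree" where "t = Node 2 [Node 1 [Leaf 1, Leaf 2], Leaf 3]"
  define B :: "(real ^ 3) set" where "B = {x. lp_eval t x \<le> 1}"
  define proj :: "real ^ 3 \<Rightarrow> real ^ 2" where "proj x = vector [x $ 1, x $ 3]" for x
  define M where "M = distr (uniform_measure lborel B) borel proj"
  have eval: "lp_eval t x = ((\<bar>x $ 1\<bar> powr 1 + \<bar>x $ 2\<bar> powr 1) powr (2 / 1)
      + \<bar>x $ 3\<bar> powr 2) powr (1 / 2)" for x
    by (simp add: t_def)
  have nested: "Lp_nested (lp_eval t)"
    unfolding Lp_nested_def
  proof (intro exI conjI)
    have leaves: "leaves t = [1, 2, 3]"
      by (simp add: t_def)
    show "proper_nodes t"
      by (simp add: t_def)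
    show "set (leaves t) = UNIV"
      by (simp add: leaves UNIV_3)
    \<comment> \<open>Three leaves cover a type with three elements, so none is repeated; this
      avoids comparing the numerals of type \<open>3\<close>.\<close>
    then have "card (set (leaves t)) = length (leaves t)"
      by (simp add: leaves)
    then show "distinct (leaves t)"
      by (rule card_distinct)
  qed (rule refl)
  \<comment> \<open>Squaring removes the root, and expanding the square of |x1| + |x2| leaves one
    mixed term.\<close>
  have B_iff: "x \<in> B \<longleftrightarrow> (x $ 1)\<^sup>2 + (x $ 2)\<^sup>2 + (x $ 3)\<^sup>2 + 2 * \<bar>x $ 1\<bar> * \<bar>x $ 2\<bar> \<le> 1" for x
    by (simp add: B_def eval powr_half_sqrt power2_sum algebra_simps)
  have B_eq: "B = {x. (x $ 1)\<^sup>2 + (x $ 2)\<^sup>2 + (x $ 3)\<^sup>2 + 2 * \<bar>x $ 1\<bar> * \<bar>x $ 2\<bar> \<le> 1}"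
    using B_iff by blast
  have "closed B"
    unfolding B_eq by (intro closed_Collect_le continuous_intros)
  then have [measurable]: "B \<in> sets borel"
    by (rule borel_closed)
  \<comment> \<open>Written coordinatewise, the projection is visibly continuous.\<close>
  have proj_eq: "proj = (\<lambda>x. \<chi> i. x $ (if i = 1 then 1 else 3))"
    by (auto simp: fun_eq_iff vec_eq_iff proj_def forall_2)
  have [measurable]: "proj \<in> borel_measurable borel"
    unfolding proj_eq by (intro borel_measurable_continuous_onI continuous_intros)
  have "B \<subseteq> cball 0 1"
  proof
    fix x assume "x \<in> B"
    moreover have "0 \<le> 2 * \<bar>x $ 1\<bar> * \<bar>x $ 2\<bar>"
      by simp
    ultimately have "(x $ 1)\<^sup>2 + (x $ 2)\<^sup>2 + (x $ 3)\<^sup>2 \<le> 1"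
      unfolding B_iff by linarith
    then show "x \<in> cball 0 1"
      by (simp add: norm_vec_def L2_set_def sum_3)
  qed
  then have finite_B: "emeasure lborel B < \<infinity>"
    by (meson bounded_cball bounded_subset emeasure_bounded_finite)

  define A where "A = {x :: real ^ 3. \<bar>x $ 3\<bar> < \<bar>x $ 1\<bar>}"
  define A' where "A' = {x :: real ^ 3. \<bar>x $ 1\<bar> < \<bar>x $ 3\<bar>}"
  define B' where "B' = {x. swap_coords 1 3 x \<in> B}"
  \<comment> \<open>Points of \<open>A\<close> gained by the exchange: inside \<open>B'\<close> but
    outside \<open>B\<close>. The strict inequalities make the set open, so one point suffices for
    positive volume.\<close>
  define D where "D = {x :: real ^ 3. \<bar>x $ 3\<bar> < \<bar>x $ 1\<bar>
    \<and> (x $ 1)\<^sup>2 + (x $ 2)\<^sup>2 + (x $ 3)\<^sup>2 + 2 * \<bar>x $ 3\<bar> * \<bar>x $ 2\<bar> < 1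
    \<and> 1 < (x $ 1)\<^sup>2 + (x $ 2)\<^sup>2 + (x $ 3)\<^sup>2 + 2 * \<bar>x $ 1\<bar> * \<bar>x $ 2\<bar>}"
  have B'_iff: "x \<in> B' \<longleftrightarrow> (x $ 1)\<^sup>2 + (x $ 2)\<^sup>2 + (x $ 3)\<^sup>2 + 2 * \<bar>x $ 3\<bar> * \<bar>x $ 2\<bar> \<le> 1" for x
    by (simp add: B'_def B_iff Transposition.transpose_def add_ac)
  have [measurable]: "B' \<in> sets borel"
    unfolding B'_def by measurable
  have "open A" "open A'" "open D"
    unfolding A_def A'_def D_def
    by (intro open_Collect_conj open_Collect_less continuous_intros)+
  then have [measurable]: "A \<in> sets borel" "A' \<in> sets borel" "D \<in> sets borel"
    by auto
  \<comment> \<open>With x3 = 0 the exchanged mixed term vanishes: the exchanged form is 18/25, the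
    original one 36/25.\<close>
  have "vector [3/5, 3/5, 0] \<in> D"
    by (simp add: D_def power2_eq_square)
  then have D_pos: "emeasure lborel D > 0"
    using emeasure_lborel_open_pos \<open>open D\<close> by blast
  have sub: "(A \<inter> B) \<union> D \<subseteq> A \<inter> B'" and disj: "(A \<inter> B) \<inter> D = {}"
  proof -
    have "x \<in> B'" if "x \<in> A" "x \<in> B" for x
    proof -
      have "\<bar>x $ 3\<bar> * \<bar>x $ 2\<bar> \<le> \<bar>x $ 1\<bar> * \<bar>x $ 2\<bar>"
        using that by (intro mult_right_mono) (auto simp: A_def)
      then show ?thesis
        using that B_iff B'_iff by (simp add: mult.assoc)
    qed
    then show "(A \<inter> B) \<union> D \<subseteq> A \<inter> B'"
      by (auto simp: D_def A_def B'_iff)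
    show "(A \<inter> B) \<inter> D = {}"
      by (auto simp: D_def B_iff)
  qed
  have "emeasure lborel (A \<inter> B) + emeasure lborel D \<le> emeasure lborel (A \<inter> B')"
    using emeasure_mono [OF sub, of lborel] disj by (subst plus_emeasure) auto
  \<comment> \<open>Exchanging x1 and x3 turns \<open>A\<close> into \<open>A'\<close> and
    \<open>B'\<close> into \<open>B\<close>, so the two intersections have equal volume.\<close>
  moreover have "A \<inter> B' = {x. swap_coords 1 3 x \<in> A' \<inter> B}"
    by (auto simp: A_def A'_def B'_def Transposition.transpose_def)
  then have "emeasure lborel (A \<inter> B') = emeasure lborel (A' \<inter> B)"
    by (simp only:) (rule emeasure_lborel_swap_coords, measurable)
  \<comment> \<open>In \<open>ennreal\<close>, adding a positive amount is a strict increase only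
    below \<top>.\<close>
  moreover have "emeasure lborel (A \<inter> B) \<noteq> \<top>"
    using finite_B emeasure_mono [of "A \<inter> B" B lborel] by (auto simp: top_unique)
  then have "emeasure lborel (A \<inter> B) < emeasure lborel (A \<inter> B) + emeasure lborel D"
    using D_pos ennreal_add_left_cancel_less [of "emeasure lborel (A \<inter> B)" 0 "emeasure lborel D"]
    by simp
  ultimately have less: "emeasure lborel (A \<inter> B) < emeasure lborel (A' \<inter> B)"
    by order
  then have pos_B: "emeasure lborel B > 0"
    using emeasure_mono [of "A' \<inter> B" B lborel] by (auto intro: le_less_trans less_le_trans)

  have "\<not> Lp_nested_symmetric M"
  proof
    assume "Lp_nested_symmetric M"
    then have swap: "distr M borel (swap_coords 1 2) = M"
      by (rule Lp_nested_symmetric_exchangeable)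
    \<comment> \<open>The second coordinate in the plane is x3, so \<open>C\<close> pulls back to
      \<open>A\<close> under \<open>proj\<close>, and its exchanged version to
      \<open>A'\<close>.\<close>
    define C :: "(real ^ 2) set" where "C = {y. \<bar>y $ 2\<bar> < \<bar>y $ 1\<bar>}"
    have "open C"
      unfolding C_def by (intro open_Collect_less continuous_intros)
    then have [measurable]: "C \<in> sets borel"
      by auto
    have "emeasure M {y. swap_coords 1 2 y \<in> C} = emeasure (distr M borel (swap_coords 1 2)) C"
      by (simp add: emeasure_distr M_def vimage_def)
    then have "emeasure M {y. swap_coords 1 2 y \<in> C} = emeasure M C"
      by (simp add: swap)
    moreover have "emeasure M E = emeasure lborel (proj -` E \<inter> B) / emeasure lborel B"
      if "E \<in> sets borel" for E
    proof -
      have "proj -` E \<in> sets borel"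
        using measurable_sets [of proj borel borel E] that by simp
      then show ?thesis
        using that by (simp add: M_def emeasure_distr Int_commute)
    qed
    moreover have "proj -` C = A" "proj -` {y. swap_coords 1 2 y \<in> C} = A'"
      by (auto simp: A_def A'_def C_def proj_def)
    ultimately have "emeasure lborel (A' \<inter> B) / emeasure lborel B
        = emeasure lborel (A \<inter> B) / emeasure lborel B"
      by simp
    \<comment> \<open>The volume of \<open>B\<close> is positive and finite, so its inverse can be
      cancelled, contradicting \<open>less\<close>.\<close>
    then show False
      using less pos_B finite_B
      by (auto simp: divide_ennreal_def mult.commute [of _ "inverse _"] ennreal_mult_cancel_left)
  qed
  then show ?thesis
    using nested eval
    by (intro exI [of _ "lp_eval t"] exI [of _ 2] exI [of _ 1]) (simp add: M_def B_def proj_def [abs_def])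
qed

end
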